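(* Let $n,k$ be integers with $k\ge 2$. For $k$-subsets $\alpha,\beta$ of $[n]$ and $0\le i\le k$, let $D_i$ be the $\binom{n}{k}\times\binom{n}{k}$ matrix indexed by $\binom{[n]}{k}$ with $(D_i)_{\alpha,\beta}=\binom{|\alpha\setminus\beta|}{i}=\binom{k-|\alpha\cap\beta|}{i}$. Let \[A_2=\sum_{i=0}^{1}(-1)^{1-i}\binom{k-1-i}{k-2}\binom{n-k-2+i}{k-2}^{-1}D_{k-i} = -\frac{k-1}{\binom{n-k-2}{k-2}}D_k+\frac{1}{\binom{n-k-1}{k-2}}D_{k-1},\] let $J$ be the $\binom{n}{k}\times\binom{n}{k}$ all-ones matrix, and let $M=J-\binom{n-2}{k-2}A_2$. Then: (1) if $n\le k^2-k+1$, then for any two $k$-element subsets $A,B$ of $[n]$ with $|A\cap B|\ne 1$ we have $M_{A,B}\ge 1$; (2) if $n\ge 3k-3$, then the largest eigenvalue of $M$ is $\binom{n-2}{k-2}$.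
   Context: $\binom{[n]}{k}$ denotes the set of $k$-element subsets of $[n]=\{1,\dots,n\}$. The matrix $A_2$ (Wilson's matrix with $t=2$) is only defined when the binomial coefficients $\binom{n-k-2}{k-2}$ and $\binom{n-k-1}{k-2}$ appearing in denominators are nonzero; this is implicitly assumed. *)

theory Defs
  imports
    "HOL-Library.Ramsey"
    "Jordan_Normal_Form.Char_Poly"
begin

text \<open>
  Matrices with rows and columns indexed by the \<open>k\<close>-subsets of \<open>{1..n}\<close>, that is by
  \<open>nsets {1..n} k\<close>, are given by their entries; values at other arguments are never used.
\<close>

type_synonym set_matrix = "nat set \<Rightarrow> nat set \<Rightarrow> real"

definition D_matrix :: "nat \<Rightarrow> set_matrix" where
  "D_matrix i = (\<lambda>\<alpha> \<beta>. real (card (\<alpha> - \<beta>) choose i))"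

text \<open>
  The inverted binomial coefficients have an upper argument \<open>n - k - 2 + i\<close> that can be negative;
  for instance it is \<open>-1\<close> if \<open>k = 2\<close>, \<open>n = 3\<close>, \<open>i = 0\<close>. They are
  therefore formed over the reals, with the generalised binomial coefficient.
\<close>

definition A2_matrix :: "nat \<Rightarrow> nat \<Rightarrow> set_matrix" where
  "A2_matrix n k = (\<lambda>\<alpha> \<beta>. \<Sum>i = 0..1.
     (-1) ^ (1 - i) * real ((k - 1 - i) choose (k - 2))
       * inverse ((real n - real k - 2 + real i) gchoose (k - 2))
       * D_matrix (k - i) \<alpha> \<beta>)"

definition J_matrix :: set_matrix where
  "J_matrix = (\<lambda>\<alpha> \<beta>. 1)"

definition M_matrix :: "nat \<Rightarrow> nat \<Rightarrow> set_matrix" where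
  "M_matrix n k = (\<lambda>\<alpha> \<beta>. J_matrix \<alpha> \<beta> - real ((n - 2) choose (k - 2)) * A2_matrix n k \<alpha> \<beta>)"

text \<open>
  The entries listed along an enumeration \<open>e\<close> of the \<open>N\<close> index sets by \<open>{..<N}\<close>. The choice
  of \<open>e\<close> only permutes rows and columns simultaneously.
\<close>

definition enum_matrix :: "nat \<Rightarrow> (nat \<Rightarrow> nat set) \<Rightarrow> set_matrix \<Rightarrow> real mat" where
  "enum_matrix N e X = mat N N (\<lambda>(i, j). X (e i) (e j))"

lemma D_matrix_inter:
  assumes "\<alpha> \<in> nsets {1..n} k"
  shows "D_matrix i \<alpha> \<beta> = real ((k - card (\<alpha> \<inter> \<beta>)) choose i)"
  using assms by (auto simp: D_matrix_def nsets_def card_Diff_subset_Int)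

lemma A2_matrix_explicit:
  assumes "k \<ge> 2"
  shows "A2_matrix n k \<alpha> \<beta> =
    - (real (k - 1) / ((real n - real k - 2) gchoose (k - 2))) * D_matrix k \<alpha> \<beta>
    + 1 / ((real n - real k - 1) gchoose (k - 2)) * D_matrix (k - 1) \<alpha> \<beta>"
proof -
  obtain m where m: "k = m + 2"
    using assms by (metis add.commute le_Suc_ex)
  have *: "real n - real k - 2 + 1 = real n - real k - 1"
    by simp
  have "Suc m choose m = Suc m"
    using binomial_symmetric[of m "Suc m"] by simp
  then show ?thesis
    unfolding A2_matrix_def using * by (simp add: m divide_inverse algebra_simps)
qed

end

theory Submission
  imports Defs
begin

text \<open>
  A function \<open>h\<close> on \<open>e\<close>-subsets is harmonic if its sum over the \<open>e\<close>-supersets of every smaller set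
  vanishes; by inclusion-exclusion its sum over the \<open>e\<close>-sets missing \<open>\<sigma>\<close> is then \<open>(-1)\<^sup>e\<close> times
  its sum over the \<open>e\<close>-subsets of \<open>\<sigma>\<close>. Hence the lift of \<open>h\<close> to \<open>k\<close>-subsets is an
  eigenfunction of every \<open>D\<^sub>i\<close>, and symmetry of \<open>M\<close> shows that \<open>M\<close> has no eigenvalues besides the
  explicit ones belonging to the levels \<open>e = 0, \<dots>, k\<close>. Levels \<open>0, 1, 2\<close> yield exactly
  \<open>(n - 2) choose (k - 2)\<close>. It remains to see that \<open>A\<^sub>2\<close> has eigenvalue at least \<open>-1\<close> on every
  level \<open>e \<ge> 3\<close>: for odd \<open>e\<close> it is nonnegative, and for even \<open>e\<close> it is bounded below by monotonicity
  from level \<open>4\<close>, where the bound is attained at \<open>n = 3 k - 3\<close>.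
\<close>

section \<open>Counting subsets with prescribed elements\<close>

lemma finite_nsets [simp]: "finite V \<Longrightarrow> finite (nsets V k)"
  by (rule finite_imp_finite_nsets)

lemma card_nsets: "finite V \<Longrightarrow> card (nsets V k) = card V choose k"
proof -
  assume V: "finite V"
  then have "nsets V k = {N. N \<subseteq> V \<and> card N = k}"
    by (auto simp: nsets_def intro: finite_subset)
  with V show ?thesis by (simp add: n_subsets)
qed

text \<open>The bijection removes \<open>\<tau>\<close> from each superset. The case split matters:
  for \<open>card \<tau> > k\<close> the truncated \<open>k - card \<tau>\<close> would turn the
  binomial into 1.\<close>

lemma card_nsets_superset:
  assumes V: "finite V" and T: "\<tau> \<subseteq> V"
  shows "card {\<beta> \<in> nsets V k. \<tau> \<subseteq> \<beta>} =
    (if card \<tau> \<le> k then (card V - card \<tau>) choose (k - card \<tau>) else 0)"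
proof (cases "card \<tau> \<le> k")
  case True
  have fT: "finite \<tau>" using V T by (rule rev_finite_subset)
  have "bij_betw (\<lambda>\<gamma>. \<tau> \<union> \<gamma>) (nsets (V - \<tau>) (k - card \<tau>)) {\<beta> \<in> nsets V k. \<tau> \<subseteq> \<beta>}"
  proof (rule bij_betw_byWitness[where f' = "\<lambda>\<beta>. \<beta> - \<tau>"])
    show "(\<union>) \<tau> ` nsets (V - \<tau>) (k - card \<tau>) \<subseteq> {\<beta> \<in> nsets V k. \<tau> \<subseteq> \<beta>}"
    proof clarsimp
      fix \<gamma> assume "\<gamma> \<in> nsets (V - \<tau>) (k - card \<tau>)"
      then have "\<gamma> \<subseteq> V - \<tau>" "finite \<gamma>" "card \<gamma> = k - card \<tau>" by (auto simp: nsets_def)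
      moreover from this have "card (\<tau> \<union> \<gamma>) = card \<tau> + card \<gamma>"
        using fT by (intro card_Un_disjoint) auto
      ultimately show "\<tau> \<union> \<gamma> \<in> nsets V k" using T fT True by (auto simp: nsets_def)
    qed
  qed (use T fT in \<open>auto simp: nsets_def card_Diff_subset\<close>)
  then have "card {\<beta> \<in> nsets V k. \<tau> \<subseteq> \<beta>} = card (nsets (V - \<tau>) (k - card \<tau>))"
    using bij_betw_same_card by metis
  with True V T fT show ?thesis by (simp add: card_nsets card_Diff_subset)
next
  case False
  then have empty: "{\<beta> \<in> nsets V k. \<tau> \<subseteq> \<beta>} = {}"
    by (auto simp: nsets_def dest: card_mono)
  show ?thesis unfolding empty using False by simp
qed

text \<open>Expands the product of \<open>1 - 1\<close> over \<open>A\<close>. It serves as the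
  indicator of emptiness in the inclusion-exclusion below.\<close>

lemma sum_Pow_minus_one_power:
  assumes "finite A"
  shows "(\<Sum>X\<in>Pow A. (-1) ^ card X) = (if A = {} then 1 else 0 :: real)"
  using prod_diff_conv_sum[OF assms, of "\<lambda>_. 1 :: real" "\<lambda>_. 1"] assms
  by (auto simp: power_0_left)

section \<open>Inclusion maps between levels, and harmonic functions\<close>

definition lift_sum :: "nat \<Rightarrow> ('a set \<Rightarrow> real) \<Rightarrow> 'a set \<Rightarrow> real" where
  "lift_sum e h \<beta> = (\<Sum>\<tau>\<in>nsets \<beta> e. h \<tau>)"

definition star_sum :: "'a set \<Rightarrow> nat \<Rightarrow> ('a set \<Rightarrow> real) \<Rightarrow> 'a set \<Rightarrow> real" where
  "star_sum V k f \<tau> = (\<Sum>\<beta> | \<beta> \<in> nsets V k \<and> \<tau> \<subseteq> \<beta>. f \<beta>)"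

text \<open>The lifts of such functions to \<open>k\<close>-subsets lie in the \<open>e\<close>-th
  eigenspace of the Johnson scheme. For \<open>e = 0\<close> the condition is vacuous, so constants
  qualify.\<close>

definition harmonic :: "'a set \<Rightarrow> nat \<Rightarrow> ('a set \<Rightarrow> real) \<Rightarrow> bool" where
  "harmonic V e h \<longleftrightarrow> (\<forall>\<rho>. \<rho> \<subseteq> V \<longrightarrow> card \<rho> < e \<longrightarrow> star_sum V e h \<rho> = 0)"

lemma star_sum_full_level:
  assumes "\<tau> \<in> nsets V k"
  shows "star_sum V k f \<tau> = f \<tau>"
proof -
  have "{\<beta>. \<beta> \<in> nsets V k \<and> \<tau> \<subseteq> \<beta>} = {\<tau>}"
    using assms by (auto simp: nsets_def dest: card_subset_eq)
  then show ?thesis by (simp add: star_sum_def)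
qed

text \<open>Double counting of pairs \<open>\<tau> \<subseteq> \<beta>\<close>: the two operations
  are multiplication by an inclusion matrix and by its transpose.\<close>

lemma sum_mult_lift_sum:
  assumes "finite V"
  shows "(\<Sum>\<beta>\<in>nsets V k. f \<beta> * lift_sum e h \<beta>) = (\<Sum>\<tau>\<in>nsets V e. star_sum V k f \<tau> * h \<tau>)"
proof -
  have "(\<Sum>\<beta>\<in>nsets V k. f \<beta> * lift_sum e h \<beta>) =
      (\<Sum>\<beta>\<in>nsets V k. \<Sum>\<tau> | \<tau> \<in> nsets V e \<and> \<tau> \<subseteq> \<beta>. f \<beta> * h \<tau>)"
    unfolding lift_sum_def sum_distrib_left
    by (intro sum.cong refl) (auto simp: nsets_def)
  also have "\<dots> = (\<Sum>\<tau>\<in>nsets V e. \<Sum>\<beta> | \<beta> \<in> nsets V k \<and> \<tau> \<subseteq> \<beta>. f \<beta> * h \<tau>)"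
    using assms by (intro sum.swap_restrict) auto
  finally show ?thesis by (simp add: star_sum_def sum_distrib_right)
qed

text \<open>Each \<open>\<beta>\<close> containing \<open>\<rho>\<close> is counted once for every
  \<open>e\<close>-set between \<open>\<rho>\<close> and \<open>\<beta>\<close>.\<close>

lemma star_sum_star_sum:
  assumes V: "finite V" and R: "\<rho> \<subseteq> V" "card \<rho> \<le> e"
  shows "star_sum V e (star_sum V k f) \<rho> = real ((k - card \<rho>) choose (e - card \<rho>)) * star_sum V k f \<rho>"
proof -
  have "star_sum V e (star_sum V k f) \<rho> =
     (\<Sum>\<tau>\<in>{\<tau> \<in> nsets V e. \<rho> \<subseteq> \<tau>}. \<Sum>\<beta> | \<beta> \<in> nsets V k \<and> \<tau> \<subseteq> \<beta>. f \<beta>)"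
    by (simp add: star_sum_def)
  also have "\<dots> = (\<Sum>\<beta>\<in>nsets V k. \<Sum>\<tau> | \<tau> \<in> {\<tau> \<in> nsets V e. \<rho> \<subseteq> \<tau>} \<and> \<tau> \<subseteq> \<beta>. f \<beta>)"
    using V by (intro sum.swap_restrict) auto
  also have "\<dots> = (\<Sum>\<beta>\<in>nsets V k. if \<rho> \<subseteq> \<beta> then real ((k - card \<rho>) choose (e - card \<rho>)) * f \<beta> else 0)"
  proof (intro sum.cong refl)
    fix \<beta> assume b: "\<beta> \<in> nsets V k"
    have eq: "{\<tau>. \<tau> \<in> {\<tau> \<in> nsets V e. \<rho> \<subseteq> \<tau>} \<and> \<tau> \<subseteq> \<beta>} = {\<tau> \<in> nsets \<beta> e. \<rho> \<subseteq> \<tau>}"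
      using b by (auto simp: nsets_def)
    show "(\<Sum>\<tau> | \<tau> \<in> {\<tau> \<in> nsets V e. \<rho> \<subseteq> \<tau>} \<and> \<tau> \<subseteq> \<beta>. f \<beta>) =
      (if \<rho> \<subseteq> \<beta> then real ((k - card \<rho>) choose (e - card \<rho>)) * f \<beta> else 0)"
    proof (cases "\<rho> \<subseteq> \<beta>")
      case True
      have "finite \<beta>" "card \<beta> = k" using b by (auto simp: nsets_def)
      with True R show ?thesis
        unfolding eq by (simp add: card_nsets_superset)
    next
      case False
      then have empty: "{\<tau> \<in> nsets \<beta> e. \<rho> \<subseteq> \<tau>} = {}" by (auto simp: nsets_def)
      show ?thesis unfolding eq empty using False by simp
    qed
  qed
  also have "\<dots> = real ((k - card \<rho>) choose (e - card \<rho>)) * star_sum V k f \<rho>"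
    using V by (simp add: star_sum_def sum_distrib_left sum.If_cases Int_def)
  finally show ?thesis .
qed

text \<open>Star sums compose up to a factor, so vanishing below level \<open>e\<close> is
  inherited. This extracts a harmonic function from an arbitrary eigenfunction.\<close>

lemma harmonic_star_sum:
  assumes V: "finite V"
    and zero: "\<And>\<rho>. \<rho> \<subseteq> V \<Longrightarrow> card \<rho> < e \<Longrightarrow> star_sum V k f \<rho> = 0"
  shows "harmonic V e (star_sum V k f)"
  using assms by (auto simp: harmonic_def star_sum_star_sum)

lemma harmonic_sum_disjoint:
  assumes V: "finite V" and h: "harmonic V e h" and S: "\<sigma> \<subseteq> V"
  shows "(\<Sum>\<tau> | \<tau> \<in> nsets V e \<and> \<tau> \<inter> \<sigma> = {}. h \<tau>) = (-1) ^ e * lift_sum e h \<sigma>"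
proof -
  have fS: "finite \<sigma>" using V S by (rule rev_finite_subset)
  have "(\<Sum>\<tau> | \<tau> \<in> nsets V e \<and> \<tau> \<inter> \<sigma> = {}. h \<tau>) =
      (\<Sum>\<tau>\<in>nsets V e. \<Sum>\<rho>\<in>Pow (\<tau> \<inter> \<sigma>). (-1) ^ card \<rho> * h \<tau>)"
    using V fS
    by (simp add: sum_distrib_right[symmetric] sum_Pow_minus_one_power if_distribR sum.If_cases
        if_distrib[where f = "\<lambda>x. x * _"] Int_def del: Int_iff)
  also have "\<dots> = (\<Sum>\<tau>\<in>nsets V e. \<Sum>\<rho> | \<rho> \<in> Pow \<sigma> \<and> \<rho> \<subseteq> \<tau>. (-1) ^ card \<rho> * h \<tau>)"
    by (intro sum.cong refl) auto
  also have "\<dots> = (\<Sum>\<rho>\<in>Pow \<sigma>. \<Sum>\<tau> | \<tau> \<in> nsets V e \<and> \<rho> \<subseteq> \<tau>. (-1) ^ card \<rho> * h \<tau>)"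
    using V fS by (intro sum.swap_restrict) auto
  also have "\<dots> = (\<Sum>\<rho>\<in>Pow \<sigma>. (-1) ^ card \<rho> * star_sum V e h \<rho>)"
    by (simp add: star_sum_def sum_distrib_left)
  \<comment> \<open>Sets smaller than \<open>e\<close> drop out by harmonicity, larger ones because
    no \<open>e\<close>-set contains them.\<close>
  also have "\<dots> = (\<Sum>\<rho>\<in>nsets \<sigma> e. (-1) ^ card \<rho> * star_sum V e h \<rho>)"
  proof (intro sum.mono_neutral_right ballI)
    fix \<rho> assume "\<rho> \<in> Pow \<sigma> - nsets \<sigma> e"
    then have r: "\<rho> \<subseteq> V" "finite \<rho>" "card \<rho> \<noteq> e"
      using S fS by (auto simp: nsets_def intro: finite_subset)
    show "(-1) ^ card \<rho> * star_sum V e h \<rho> = 0"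
    proof (cases "card \<rho> < e")
      case True
      with h r show ?thesis by (simp add: harmonic_def)
    next
      case False
      with r have "{\<tau>. \<tau> \<in> nsets V e \<and> \<rho> \<subseteq> \<tau>} = {}"
        by (auto simp: nsets_def dest: card_mono)
      then show ?thesis by (simp only: star_sum_def) simp
    qed
  qed (use fS in \<open>auto simp: nsets_def\<close>)
  also have "\<dots> = (\<Sum>\<rho>\<in>nsets \<sigma> e. (-1) ^ e * h \<rho>)"
  proof (intro sum.cong refl)
    fix \<rho> assume r: "\<rho> \<in> nsets \<sigma> e"
    then have "\<rho> \<in> nsets V e" using S by (auto simp: nsets_def)
    with r show "(-1) ^ card \<rho> * star_sum V e h \<rho> = (-1) ^ e * h \<rho>"
      by (simp add: star_sum_full_level) (simp add: nsets_def)
  qed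
  finally show ?thesis by (simp add: lift_sum_def sum_distrib_left)
qed

section \<open>Action of \<open>D_matrix\<close> on lifts of harmonic functions\<close>

text \<open>Inside \<open>V - \<sigma>\<close> every \<open>e\<close>-set lies in equally many
  \<open>k\<close>-sets, so adjointness reduces the claim to \<open>harmonic_sum_disjoint\<close>.
  If \<open>V - \<sigma>\<close> has fewer than \<open>e\<close> elements, the subtraction
  truncates, but then \<open>lift_sum e h \<sigma>\<close> is an empty sum up to sign and both sides
  vanish.\<close>

lemma sum_lift_sum_disjoint:
  assumes V: "finite V" and h: "harmonic V e h" and S: "\<sigma> \<subseteq> V" and e: "e \<le> k"
  shows "(\<Sum>\<beta> | \<beta> \<in> nsets V k \<and> \<beta> \<inter> \<sigma> = {}. lift_sum e h \<beta>) =
    (-1) ^ e * real ((card V - card \<sigma> - e) choose (k - e)) * lift_sum e h \<sigma>"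
proof -
  have fS: "finite \<sigma>" using V S by (rule rev_finite_subset)
  let ?c = "real ((card V - card \<sigma> - e) choose (k - e))"
  have star: "star_sum (V - \<sigma>) k (\<lambda>_. 1) \<tau> = ?c" if "\<tau> \<in> nsets (V - \<sigma>) e" for \<tau>
  proof -
    have "\<tau> \<subseteq> V - \<sigma>" "card \<tau> = e" using that by (auto simp: nsets_def)
    with V e S fS show ?thesis
      by (simp add: star_sum_def card_nsets_superset card_Diff_subset)
  qed
  have ns: "nsets (V - \<sigma>) j = {\<beta>. \<beta> \<in> nsets V j \<and> \<beta> \<inter> \<sigma> = {}}" for j
    by (auto simp: nsets_def)
  have "(\<Sum>\<beta> | \<beta> \<in> nsets V k \<and> \<beta> \<inter> \<sigma> = {}. lift_sum e h \<beta>) =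
      (\<Sum>\<tau>\<in>nsets (V - \<sigma>) e. ?c * h \<tau>)"
    using sum_mult_lift_sum[of "V - \<sigma>" "\<lambda>_. 1" e h k] V star by (simp add: ns[symmetric])
  also have "\<dots> = ?c * ((-1) ^ e * lift_sum e h \<sigma>)"
    unfolding sum_distrib_left[symmetric] ns harmonic_sum_disjoint[OF V h S] ..
  finally show ?thesis by simp
qed

text \<open>The same adjointness, now with \<open>\<alpha>\<close> as ground set and the constant
  function 1.\<close>

lemma sum_lift_sum_nsets:
  assumes A: "finite \<alpha>"
  shows "(\<Sum>\<sigma>\<in>nsets \<alpha> i. lift_sum e h \<sigma>) =
    (if e \<le> i then real ((card \<alpha> - e) choose (i - e)) else 0) * lift_sum e h \<alpha>"
proof -
  have "star_sum \<alpha> i (\<lambda>_. 1) \<tau> = (if e \<le> i then real ((card \<alpha> - e) choose (i - e)) else 0)"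
    if "\<tau> \<in> nsets \<alpha> e" for \<tau>
  proof -
    have "\<tau> \<subseteq> \<alpha>" "card \<tau> = e" using that by (auto simp: nsets_def)
    with A show ?thesis by (simp add: star_sum_def card_nsets_superset)
  qed
  with sum_mult_lift_sum[OF A, of "\<lambda>_. 1" e h i] show ?thesis
    by (simp add: lift_sum_def[of e h \<alpha>] sum_distrib_left)
qed

text \<open>
  Counting the pairs \<open>(\<beta>, \<sigma>)\<close> with \<open>\<sigma>\<close> an \<open>i\<close>-subset of \<open>\<alpha> - \<beta>\<close> reduces the action of
  \<open>D\<^sub>i\<close> to the two preceding lemmas.
\<close>

lemma D_matrix_lift_sum:
  assumes V: "finite V" and h: "harmonic V e h" and e: "e \<le> k" and a: "\<alpha> \<in> nsets V k"
  shows "(\<Sum>\<beta>\<in>nsets V k. D_matrix i \<alpha> \<beta> * lift_sum e h \<beta>) =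
    (-1) ^ e * (if e \<le> i then real ((k - e) choose (i - e)) else 0)
      * real ((card V - i - e) choose (k - e)) * lift_sum e h \<alpha>"
proof -
  have A: "\<alpha> \<subseteq> V" "finite \<alpha>" "card \<alpha> = k" using a by (auto simp: nsets_def)
  have "(\<Sum>\<beta>\<in>nsets V k. D_matrix i \<alpha> \<beta> * lift_sum e h \<beta>) =
      (\<Sum>\<beta>\<in>nsets V k. \<Sum>\<sigma> | \<sigma> \<in> nsets \<alpha> i \<and> \<beta> \<inter> \<sigma> = {}. lift_sum e h \<beta>)"
  proof (intro sum.cong refl)
    fix \<beta>
    have "{\<sigma>. \<sigma> \<in> nsets \<alpha> i \<and> \<beta> \<inter> \<sigma> = {}} = nsets (\<alpha> - \<beta>) i" by (auto simp: nsets_def)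
    with A show "D_matrix i \<alpha> \<beta> * lift_sum e h \<beta> =
        (\<Sum>\<sigma> | \<sigma> \<in> nsets \<alpha> i \<and> \<beta> \<inter> \<sigma> = {}. lift_sum e h \<beta>)"
      by (simp add: D_matrix_def card_nsets)
  qed
  also have "\<dots> = (\<Sum>\<sigma>\<in>nsets \<alpha> i. \<Sum>\<beta> | \<beta> \<in> nsets V k \<and> \<beta> \<inter> \<sigma> = {}. lift_sum e h \<beta>)"
    using V A by (intro sum.swap_restrict) auto
  also have "\<dots> = (\<Sum>\<sigma>\<in>nsets \<alpha> i. (-1) ^ e * real ((card V - i - e) choose (k - e)) * lift_sum e h \<sigma>)"
  proof (intro sum.cong refl)
    fix \<sigma> assume "\<sigma> \<in> nsets \<alpha> i"
    then have "\<sigma> \<subseteq> V" "card \<sigma> = i" using A by (auto simp: nsets_def)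
    with sum_lift_sum_disjoint[OF V h _ e]
    show "(\<Sum>\<beta> | \<beta> \<in> nsets V k \<and> \<beta> \<inter> \<sigma> = {}. lift_sum e h \<beta>) =
      (-1) ^ e * real ((card V - i - e) choose (k - e)) * lift_sum e h \<sigma>" by blast
  qed
  also have "\<dots> = (-1) ^ e * real ((card V - i - e) choose (k - e)) * (\<Sum>\<sigma>\<in>nsets \<alpha> i. lift_sum e h \<sigma>)"
    by (simp add: sum_distrib_left)
  also have "\<dots> = (-1) ^ e * (if e \<le> i then real ((k - e) choose (i - e)) else 0)
      * real ((card V - i - e) choose (k - e)) * lift_sum e h \<alpha>"
    using A by (simp add: sum_lift_sum_nsets)
  finally show ?thesis .
qed

section \<open>Eigenvalues of \<open>A2_matrix\<close> on the levels\<close>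

text \<open>Combines the level-\<open>e\<close> eigenvalues of \<open>D_matrix (k - 1)\<close> and
  \<open>D_matrix k\<close>. The factor \<open>k - e\<close> is
  \<open>(k - e) choose (k - 1 - e)\<close> for \<open>e < k\<close>; at \<open>e = k\<close> it is
  0, as \<open>D_matrix (k - 1)\<close> annihilates that level.\<close>

definition A2_eigenvalue :: "nat \<Rightarrow> nat \<Rightarrow> nat \<Rightarrow> real" where
  "A2_eigenvalue n k e = (-1) ^ e *
     (real (k - e) * real ((n + 1 - k - e) choose (k - e)) / ((real n - real k - 1) gchoose (k - 2))
      - real (k - 1) * real ((n - k - e) choose (k - e)) / ((real n - real k - 2) gchoose (k - 2)))"

lemma binomial_absorb_twice:
  assumes "2 \<le> k" "k \<le> n"
  shows "real k * (real k - 1) * real (n choose k) = real n * (real n - 1) * real ((n - 2) choose (k - 2))"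
proof -
  obtain j m where jm: "k = j + 2" "n = m + 2"
    using assms by (metis add.commute le_Suc_ex le_trans)
  have "real (j + 2) * real ((m + 2) choose (j + 2)) = real (m + 2) * real ((m + 1) choose (j + 1))"
    using Suc_times_binomial[of "j + 1" "m + 1"] by (metis add_2_eq_Suc' Suc_eq_plus1 of_nat_mult)
  moreover have "real (j + 1) * real ((m + 1) choose (j + 1)) = real (m + 1) * real (m choose j)"
    using Suc_times_binomial[of j m] by (metis Suc_eq_plus1 of_nat_mult)
  ultimately have "real (j + 1) * (real (j + 2) * real ((m + 2) choose (j + 2))) =
      real (m + 2) * (real (m + 1) * real (m choose j))"
    by (metis mult.left_commute)
  then show ?thesis unfolding jm by (simp add: algebra_simps)
qed

text \<open>Writing \<open>n = k + a\<close> with \<open>k \<le> a\<close> makes the upper arguments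
  nonnegative, so the generalised binomials are ordinary ones; absorption then fixes their
  ratio.\<close>

lemma A2_denominators:
  assumes "2 \<le> k" "k \<le> a"
  shows "(real (k + a) - real k - 2) gchoose (k - 2) = real ((a - 2) choose (k - 2))"
    and "(real (k + a) - real k - 1) gchoose (k - 2) = real ((a - 1) choose (k - 2))"
    and "(real a + 1 - real k) * real ((a - 1) choose (k - 2)) =
      (real a - 1) * real ((a - 2) choose (k - 2))"
proof -
  show P: "(real (k + a) - real k - 2) gchoose (k - 2) = real ((a - 2) choose (k - 2))"
    using assms by (simp add: binomial_gbinomial of_nat_diff)
  show Q: "(real (k + a) - real k - 1) gchoose (k - 2) = real ((a - 1) choose (k - 2))"
    using assms by (simp add: binomial_gbinomial of_nat_diff)
  have shift: "real (k + a) - real k - 1 - 1 = real (k + a) - real k - 2"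
      "real (k + a) - real k - 1 - real (k - 2) = real a + 1 - real k"
    using assms by (simp_all add: of_nat_diff)
  show "(real a + 1 - real k) * real ((a - 1) choose (k - 2)) =
      (real a - 1) * real ((a - 2) choose (k - 2))"
    using gbinomial_absorb_comp[of "real (k + a) - real k - 1" "k - 2", unfolded shift P Q] by simp
qed

text \<open>Absorption expresses both summands through the same quotient of binomials, leaving a
  quadratic in \<open>e\<close>. The quadratic equals \<open>a - 1\<close> at \<open>e = 2\<close>,
  where the eigenvalue is therefore -1.\<close>

lemma A2_eigenvalue_closed:
  assumes k: "3 \<le> k" "k \<le> a" and e: "e \<le> k"
  shows "A2_eigenvalue (k + a) k e =
    - ((-1) ^ e) * real ((a - e) choose (k - e)) / real ((a - 2) choose (k - 2))
      * (real e * (real k + real a + 1 - real e) - (2 * real k + real a - 1)) / (real a - 1)"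
proof -
  define G where "G = real e * (real k + real a + 1 - real e) - (2 * real k + real a - 1)"
  define P Q X Y where "P = real ((a - 2) choose (k - 2))" "Q = real ((a - 1) choose (k - 2))"
    "X = real ((a - e) choose (k - e))" "Y = real ((a + 1 - e) choose (k - e))"
  have pos: "P > 0" "Q > 0" using k by (auto simp: P_Q_X_Y_def)
  have "(a + 1 - k) * ((a + 1 - e) choose (k - e)) = (a + 1 - e) * ((a - e) choose (k - e))"
    using binomial_absorb_comp[of "a + 1 - e" "k - e"] e by simp
  then have "real (a + 1 - k) * Y = real (a + 1 - e) * X"
    unfolding P_Q_X_Y_def by (metis of_nat_mult)
  then have Y: "(real a + 1 - real k) * Y = (real a + 1 - real e) * X"
    using k e by (simp add: of_nat_diff add.commute)
  have gP: "(real (k + a) - real k - 2) gchoose (k - 2) = P"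
    and gQ: "(real (k + a) - real k - 1) gchoose (k - 2) = Q"
    and Q: "(real a + 1 - real k) * Q = (real a - 1) * P"
    using A2_denominators[of k a] k by (simp_all add: P_Q_X_Y_def)
  \<comment> \<open>The positive factor \<open>a + 1 - k\<close> occurs in the relations for both
    \<open>Y\<close> and \<open>Q\<close>, so it cancels from \<open>Y / Q\<close>.\<close>
  have "(real a + 1 - real k) * (Y * ((real a - 1) * P)) = (real a + 1 - real k) * ((real a + 1 - real e) * X * Q)"
    using Y Q by (metis (no_types, opaque_lifting) mult.assoc mult.left_commute)
  then have "Y * ((real a - 1) * P) = (real a + 1 - real e) * X * Q"
    using k by simp
  then have YQ: "Y / Q = (real a + 1 - real e) * X / ((real a - 1) * P)"
    using pos k by (simp add: field_simps)
  have "A2_eigenvalue (k + a) k e =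
      (-1) ^ e * ((real k - real e) * (Y / Q) - (real k - 1) * X / P)"
    using k e unfolding A2_eigenvalue_def gP gQ by (simp add: P_Q_X_Y_def of_nat_diff)
  also have "\<dots> = (-1) ^ e * (X / P) * (((real k - real e) * (real a + 1 - real e) - (real k - 1) * (real a - 1)) / (real a - 1))"
    unfolding YQ using pos k by (simp add: field_simps)
  also have "(real k - real e) * (real a + 1 - real e) - (real k - 1) * (real a - 1) =
      - G"
    by (simp add: G_def algebra_simps)
  finally have "A2_eigenvalue (k + a) k e = - ((-1) ^ e) * X / P * G / (real a - 1)" by simp
  then show ?thesis by (simp only: P_Q_X_Y_def G_def)
qed

text \<open>
  With \<open>a = n - k\<close>, this bounds the eigenvalue of \<open>A\<^sub>2\<close> on the even levels. The left-hand side decreases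
  in \<open>e\<close>: from \<open>e\<close> to \<open>e + 1\<close> the binomial at least halves and the quadratic factor at most doubles.
\<close>

lemma binomial_times_quadratic_le:
  assumes k: "3 \<le> k" "2 * k \<le> a + 3" and e: "4 \<le> e" "e \<le> k"
  shows "real ((a - e) choose (k - e)) * (real e * (real k + real a + 1 - real e) - (2 * real k + real a - 1))
    \<le> real ((a - 2) choose (k - 2)) * (real a - 1)"
  using e
proof (induction e rule: dec_induct)
  case base
  \<comment> \<open>The extremal case \<open>a = 2 * k - 3\<close> is \<open>x = 0\<close>. In terms
    of \<open>y\<close> and \<open>x\<close> the difference of the two cubics compared below has
    nonnegative coefficients and is divisible by \<open>x\<close>.\<close>
  define y x where "y = k - 4" "x = a + 3 - 2 * k"
  have yx: "real k = real y + 4" "real a = 2 * real y + real x + 5"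
    using base k by (auto simp: y_x_def of_nat_diff)
  let ?X = "real ((a - 4) choose (k - 4))" and ?P = "real ((a - 2) choose (k - 2))"
  have "real (k - 2) * (real (k - 2) - 1) * ?P = real (a - 2) * (real (a - 2) - 1) * ?X"
    using binomial_absorb_twice[of "k - 2" "a - 2"] base k by simp
  then have P: "(real k - 2) * (real k - 3) * ?P = (real a - 2) * (real a - 3) * ?X"
    using base k by (simp add: of_nat_diff)
  have "(real k - 2) * (real k - 3) * (?X * (2 * real k + 3 * real a - 11)) =
     ?X * ((real k - 2) * (real k - 3) * (2 * real k + 3 * real a - 11))"
    by simp
  also have "\<dots> \<le> ?X * ((real a - 1) * (real a - 2) * (real a - 3))"
    unfolding yx by (intro mult_left_mono) (simp_all add: algebra_simps)
  also have "\<dots> = (real a - 1) * ((real k - 2) * (real k - 3) * ?P)"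
    unfolding P by simp
  also have "\<dots> = (real k - 2) * (real k - 3) * (?P * (real a - 1))"
    by simp
  finally have "?X * (2 * real k + 3 * real a - 11) \<le> ?P * (real a - 1)"
    by (rule mult_left_le_imp_le) (simp add: yx)
  then show ?case by (simp add: algebra_simps)
next
  case (step e)
  define g where "g x = x * (real k + real a + 1 - x) - (2 * real k + real a - 1)" for x
  have r: "4 \<le> real e" "real e + 1 \<le> real k" "2 * real k \<le> real a + 3"
    using step k by linarith+
  let ?X = "real ((a - e) choose (k - e))" and ?X' = "real ((a - Suc e) choose (k - Suc e))"
  have "(k - e) * ((a - e) choose (k - e)) = (a - e) * ((a - Suc e) choose (k - Suc e))"
    using times_binomial_minus1_eq[of "k - e" "a - e"] step by simp
  then have "real (k - e) * ?X = real (a - e) * ?X'" by (metis of_nat_mult)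
  \<comment> \<open>This ratio makes the binomial halve; it combines
    \<open>2 * k \<le> a + 3\<close> with \<open>e \<ge> 3\<close>.\<close>
  moreover have "2 * (k - e) \<le> a - e" using step k by linarith
  then have "real (2 * (k - e)) * ?X' \<le> real (a - e) * ?X'"
    by (intro mult_right_mono) (simp_all only: of_nat_le_iff of_nat_0_le_iff)
  ultimately have "real (k - e) * (2 * ?X') \<le> real (k - e) * ?X"
    by simp
  then have X: "2 * ?X' \<le> ?X" using step by simp
  \<comment> \<open>\<open>2 * g (real e) - g (real (Suc e))\<close> exceeds this product by
    \<open>k + 2 * a - 3\<close>, and \<open>g (real e)\<close> exceeds it by
    \<open>2 * k + 3 * a - 2 * e - 3\<close>; both excesses are nonnegative.\<close>
  have "0 \<le> (real e - 4) * (real k + real a - 1 - real e)"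
    using r by (intro mult_nonneg_nonneg) auto
  then have g: "g (real (Suc e)) \<le> 2 * g (real e)" and g0: "0 \<le> g (real e)"
    using r by (simp_all add: g_def algebra_simps)
  have "?X' * g (real (Suc e)) \<le> ?X' * (2 * g (real e))"
    using g by (intro mult_left_mono) auto
  also have "\<dots> \<le> ?X * g (real e)"
    using mult_right_mono[OF X g0] by simp
  also have "\<dots> \<le> real ((a - 2) choose (k - 2)) * (real a - 1)"
    using step by (simp add: g_def)
  finally show ?case by (simp add: g_def)
qed

lemma A2_eigenvalue_ge:
  assumes k: "2 \<le> k" and n: "3 * k - 3 \<le> n" and e: "1 \<le> e" "e \<le> k"
  shows "- 1 \<le> A2_eigenvalue n k e"
proof (cases "k = 2")
  \<comment> \<open>Both denominators are \<open>gchoose 0\<close>, that is 1, and the two levels 1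
    and 2 each give exactly -1.\<close>
  case True
  then obtain m where m: "n = m + 3" using n by (auto simp: le_iff_add add.commute)
  from e True have "e = 1 \<or> e = 2" by auto
  then show ?thesis unfolding A2_eigenvalue_def True m by auto
next
  case False
  then have k3: "3 \<le> k" using k by simp
  define a where "a = n - k"
  have a: "n = k + a" "2 * k \<le> a + 3" "k \<le> a" using n k3 by (auto simp: a_def)
  have ra: "real k \<ge> 3" "real a \<ge> 3" "real k \<le> real a" using k3 a by auto
  define P X g where "P = real ((a - 2) choose (k - 2))" "X = real ((a - e) choose (k - e))"
    "g = real e * (real k + real a + 1 - real e) - (2 * real k + real a - 1)"
  have P: "P > 0" using a by (simp add: P_X_g_def)
  have closed: "A2_eigenvalue n k e = - ((-1) ^ e) * X / P * g / (real a - 1)"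
    using A2_eigenvalue_closed[OF k3 a(3) e(2)] by (simp add: P_X_g_def a)
  have "e = 1 \<or> e = 2 \<or> (odd e \<and> e \<ge> 3) \<or> (even e \<and> e \<ge> 4)"
    using e by presburger
  then consider "e = 1" | "e = 2" | "odd e" "e \<ge> 3" | "even e" "e \<ge> 4"
    by blast
  then show ?thesis
  proof cases
    case 1
    have "(k - 1) * ((a - 1) choose (k - 1)) = (a - 1) * ((a - 2) choose (k - 2))"
      using times_binomial_minus1_eq[of "k - 1" "a - 1"] k3 by (simp add: numeral_2_eq_2)
    then have "real (k - 1) * X = real (a - 1) * P"
      by (simp add: P_X_g_def 1 flip: of_nat_mult)
    then have "(real k - 1) * X = (real a - 1) * P" using k3 a by (simp add: of_nat_diff)
    then have "X * g = - (P * (real a - 1))" by (simp add: P_X_g_def 1 algebra_simps)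
    then have "X * g / (P * (real a - 1)) = - 1" using P ra by simp
    with closed show ?thesis by (simp add: 1)
  next
    case 2
    then have "g = real a - 1" "X = P" by (simp_all add: P_X_g_def)
    then have "X * g / (P * (real a - 1)) = 1" using P ra by simp
    with closed show ?thesis by (simp add: 2)
  next
    case 3
    \<comment> \<open>\<open>g\<close> is this product plus \<open>a - 1\<close>, its value at level
      2.\<close>
    have "0 \<le> (real e - 2) * (real k + real a - 1 - real e)"
      using 3 e ra by (intro mult_nonneg_nonneg) auto
    then have "0 \<le> g" using ra by (simp add: P_X_g_def algebra_simps)
    then have "0 \<le> X * g / P / (real a - 1)" using P ra by (simp add: P_X_g_def)
    with closed 3 show ?thesis by simp
  next
    case 4
    have "X * g \<le> P * (real a - 1)"
      using binomial_times_quadratic_le[OF k3 a(2) 4(2) e(2)] by (simp add: P_X_g_def)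
    then have "X * g / (P * (real a - 1)) \<le> 1"
      using P ra by simp
    with closed 4 show ?thesis by simp
  qed
qed

text \<open>On level 0 the all-ones matrix contributes \<open>n choose k\<close>; this value brings
  the eigenvalue of \<open>M_matrix\<close> there to exactly
  \<open>(n - 2) choose (k - 2)\<close>.\<close>

lemma A2_eigenvalue_0:
  assumes k: "2 \<le> k" and n: "3 * k - 3 \<le> n"
  shows "real ((n - 2) choose (k - 2)) * A2_eigenvalue n k 0 = real (n choose k) - real ((n - 2) choose (k - 2))"
proof (cases "k = 2")
  case True
  then obtain m where m: "n = m + 3" using n by (auto simp: le_iff_add add.commute)
  show ?thesis unfolding A2_eigenvalue_def True m
    by (simp add: eval_nat_numeral)
next
  case False
  then have k3: "3 \<le> k" using k by simp
  define a where "a = n - k"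
  have a: "n = k + a" "2 * k \<le> a + 3" "k \<le> a" using n k3 by (auto simp: a_def)
  have ra: "real k \<ge> 3" "real a \<ge> 3" "real k \<le> real a" using k3 a by auto
  define P X where "P = real ((a - 2) choose (k - 2))" "X = real (a choose k)"
  define C where "C = real ((n - 2) choose (k - 2))"
  have P: "P > 0" using a by (simp add: P_X_def)
  define s where "s = 2 * real k + real a - 1"
  have "A2_eigenvalue n k 0 =
      - ((-1) ^ 0) * X / P * (real 0 * (real k + real a + 1 - real 0) - s) / (real a - 1)"
    using A2_eigenvalue_closed[OF k3 a(3), of 0] by (simp only: P_X_def s_def a(1) diff_zero le0)
  then have closed: "A2_eigenvalue n k 0 = X / P * s / (real a - 1)" by simp
  have "real k * (real k - 1) * X = real a * (real a - 1) * P"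
    using binomial_absorb_twice[OF k a(3)] by (simp add: P_X_def)
  then have X: "X = real a * (real a - 1) * P / (real k * (real k - 1))" using ra by (simp add: field_simps)
  have "A2_eigenvalue n k 0 = real a * s / (real k * (real k - 1))"
    unfolding closed X using P ra by simp
  \<comment> \<open>Both sides are \<open>(n - k) * (n + k - 1)\<close>.\<close>
  also have "real a * s = real n * (real n - 1) - real k * (real k - 1)"
    by (simp add: s_def a algebra_simps)
  finally have eq: "real k * (real k - 1) * A2_eigenvalue n k 0 = real n * (real n - 1) - real k * (real k - 1)"
    using ra by simp
  have "real k * (real k - 1) * (C * A2_eigenvalue n k 0) = C * (real k * (real k - 1) * A2_eigenvalue n k 0)"
    by (simp only: mult_ac)
  also have "\<dots> = real n * (real n - 1) * C - real k * (real k - 1) * C"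
    unfolding eq by (simp add: algebra_simps)
  also have "real n * (real n - 1) * C = real k * (real k - 1) * real (n choose k)"
    using binomial_absorb_twice[OF k, of n] a by (simp add: C_def)
  finally have "real k * (real k - 1) * (C * A2_eigenvalue n k 0) = real k * (real k - 1) * (real (n choose k) - C)"
    by (simp add: algebra_simps)
  then show ?thesis using ra by (simp add: C_def)
qed

section \<open>The spectrum of \<open>M_matrix\<close>\<close>

lemma card_Diff_nsets_commute:
  assumes "\<alpha> \<in> nsets V k" "\<beta> \<in> nsets V k"
  shows "card (\<alpha> - \<beta>) = card (\<beta> - \<alpha>)"
  using assms by (simp add: nsets_def card_Diff_subset_Int Int_commute)

lemma M_matrix_commute:
  assumes "\<alpha> \<in> nsets V k" "\<beta> \<in> nsets V k"
  shows "M_matrix n k \<alpha> \<beta> = M_matrix n k \<beta> \<alpha>"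
  by (simp add: M_matrix_def J_matrix_def A2_matrix_def D_matrix_def card_Diff_nsets_commute[OF assms])

text \<open>The all-ones matrix is \<open>D_matrix 0\<close>, so the action of the
  \<open>D_matrix\<close> family covers it too; its contribution survives only on level 0.\<close>

lemma M_matrix_lift_sum:
  assumes k: "2 \<le> k" and h: "harmonic {1..n} e h" and e: "e \<le> k" and a: "\<alpha> \<in> nsets {1..n} k"
  shows "(\<Sum>\<beta>\<in>nsets {1..n} k. M_matrix n k \<alpha> \<beta> * lift_sum e h \<beta>) =
    ((if e = 0 then real (n choose k) else 0) - real ((n - 2) choose (k - 2)) * A2_eigenvalue n k e)
      * lift_sum e h \<alpha>"
proof -
  define C P Q where "C = real ((n - 2) choose (k - 2))"
    "P = (real n - real k - 2) gchoose (k - 2)" "Q = (real n - real k - 1) gchoose (k - 2)"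
  define S where "S i = (\<Sum>\<beta>\<in>nsets {1..n} k. D_matrix i \<alpha> \<beta> * lift_sum e h \<beta>)" for i
  note D = D_matrix_lift_sum[OF _ h e a, folded S_def, simplified]
  have S0: "S 0 = (if e = 0 then real (n choose k) else 0) * lift_sum e h \<alpha>"
    by (simp add: D)
  have Sk: "S k = (-1) ^ e * real ((n - k - e) choose (k - e)) * lift_sum e h \<alpha>"
    using e by (simp add: D)
  have "(if e \<le> k - 1 then real ((k - e) choose (k - 1 - e)) else 0) = real (k - e)"
  proof (cases "e = k")
    case False
    then obtain j where "k = e + Suc j" using e less_imp_Suc_add[of e k] by auto
    then show ?thesis using binomial_symmetric[of j "Suc j"] by simp
  qed (use k in auto)
  then have Sk1: "S (k - 1) = (-1) ^ e * real (k - e) * real ((n + 1 - k - e) choose (k - e)) * lift_sum e h \<alpha>"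
    using k D[of "k - 1"] by simp
  have "M_matrix n k \<alpha> \<beta> = D_matrix 0 \<alpha> \<beta> + C * (real (k - 1) / P) * D_matrix k \<alpha> \<beta>
      - C / Q * D_matrix (k - 1) \<alpha> \<beta>" for \<beta>
    by (simp add: M_matrix_def J_matrix_def A2_matrix_explicit[OF k] D_matrix_def C_P_Q_def algebra_simps)
  then have "(\<Sum>\<beta>\<in>nsets {1..n} k. M_matrix n k \<alpha> \<beta> * lift_sum e h \<beta>) =
      S 0 + C * (real (k - 1) / P) * S k - C / Q * S (k - 1)"
    by (simp add: S_def sum_distrib_left sum.distrib sum_subtractf ring_distribs mult.assoc)
  also have "\<dots> = ((if e = 0 then real (n choose k) else 0) - C * A2_eigenvalue n k e) * lift_sum e h \<alpha>"
    unfolding S0 Sk Sk1 A2_eigenvalue_def C_P_Q_def(2,3)[symmetric] by (simp add: algebra_simps)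
  finally show ?thesis by (simp add: C_P_Q_def)
qed

text \<open>Transports vectors along \<open>e\<close> to functions on \<open>S\<close>, so that the
  remaining argument does not depend on the enumeration.\<close>

lemma eigenvalue_enum_matrix_iff:
  assumes b: "bij_betw e {..<N} S"
  shows "eigenvalue (enum_matrix N e X) x \<longleftrightarrow>
    (\<exists>f. (\<exists>\<alpha>\<in>S. f \<alpha> \<noteq> 0) \<and> (\<forall>\<alpha>\<in>S. (\<Sum>\<beta>\<in>S. X \<alpha> \<beta> * f \<beta>) = x * f \<alpha>))"
proof
  have img: "e ` {..<N} = S" and inj: "inj_on e {..<N}"
    using b by (auto simp: bij_betw_def)
  have row: "(enum_matrix N e X *\<^sub>v v) $ i = (\<Sum>\<beta>\<in>S. X (e i) \<beta> * f \<beta>)"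
    if "v \<in> carrier_vec N" "i < N" "\<And>j. j < N \<Longrightarrow> v $ j = f (e j)" for v f i
    using that unfolding sum.reindex_bij_betw[OF b, symmetric]
    by (auto simp: enum_matrix_def scalar_prod_def lessThan_atLeast0 intro!: sum.cong)
  {
    assume "eigenvalue (enum_matrix N e X) x"
    then obtain v where v: "v \<in> carrier_vec N" "v \<noteq> 0\<^sub>v N" "enum_matrix N e X *\<^sub>v v = x \<cdot>\<^sub>v v"
      by (auto simp: eigenvalue_def eigenvector_def enum_matrix_def)
    define f where "f = (\<lambda>\<beta>. v $ inv_into {..<N} e \<beta>)"
    have f: "v $ j = f (e j)" if "j < N" for j
      using that inj by (simp add: f_def)
    obtain j where j: "j < N" "v $ j \<noteq> 0" using v by (metis carrier_vecD eq_vecI index_zero_vec)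
    have "f (e j) \<noteq> 0" using j(2) unfolding f[OF j(1)] .
    moreover have "e j \<in> S" using j(1) img by blast
    ultimately have "\<exists>\<alpha>\<in>S. f \<alpha> \<noteq> 0" by blast
    moreover have "(\<Sum>\<beta>\<in>S. X \<alpha> \<beta> * f \<beta>) = x * f \<alpha>" if \<alpha>: "\<alpha> \<in> S" for \<alpha>
    proof -
      obtain i where i: "i < N" "\<alpha> = e i" using \<alpha> unfolding img[symmetric] by blast
      have "(\<Sum>\<beta>\<in>S. X \<alpha> \<beta> * f \<beta>) = (x \<cdot>\<^sub>v v) $ i"
        using row[OF v(1) i(1) f] v(3) i(2) by simp
      also have "\<dots> = x * v $ i" using v(1) i(1) by simp
      finally show ?thesis unfolding f[OF i(1)] i(2) .
    qed
    ultimately show "\<exists>f. (\<exists>\<alpha>\<in>S. f \<alpha> \<noteq> 0) \<and> (\<forall>\<alpha>\<in>S. (\<Sum>\<beta>\<in>S. X \<alpha> \<beta> * f \<beta>) = x * f \<alpha>)"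
      by blast
  next
    assume "\<exists>f. (\<exists>\<alpha>\<in>S. f \<alpha> \<noteq> 0) \<and> (\<forall>\<alpha>\<in>S. (\<Sum>\<beta>\<in>S. X \<alpha> \<beta> * f \<beta>) = x * f \<alpha>)"
    then obtain f where f: "\<exists>\<alpha>\<in>S. f \<alpha> \<noteq> 0" "\<And>\<alpha>. \<alpha> \<in> S \<Longrightarrow> (\<Sum>\<beta>\<in>S. X \<alpha> \<beta> * f \<beta>) = x * f \<alpha>"
      by blast
    define v where "v = vec N (\<lambda>j. f (e j))"
    have v: "v \<in> carrier_vec N" by (simp add: v_def)
    obtain j where j: "j < N" "f (e j) \<noteq> 0" using f(1) img by auto
    then have "v $ j \<noteq> 0\<^sub>v N $ j" by (simp add: v_def)
    then have "v \<noteq> 0\<^sub>v N" by auto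
    moreover have "enum_matrix N e X *\<^sub>v v = x \<cdot>\<^sub>v v"
    proof (rule eq_vecI)
      fix i assume "i < dim_vec (x \<cdot>\<^sub>v v)"
      then have i: "i < N" by (simp add: v_def)
      then have "e i \<in> S" using img by auto
      with row[OF v i, of f] f(2) i show "(enum_matrix N e X *\<^sub>v v) $ i = (x \<cdot>\<^sub>v v) $ i"
        by (simp add: v_def)
    qed (simp add: v_def enum_matrix_def)
    ultimately show "eigenvalue (enum_matrix N e X) x"
      using v by (auto simp: eigenvalue_def eigenvector_def enum_matrix_def)
  }
qed

text \<open>
  For an eigenfunction \<open>f\<close>, take the least level \<open>e\<close> on which \<open>star_sum V k f\<close> does not vanish.
  There it is harmonic, and its lift has inner product \<open>\<Sum>\<tau>. (star_sum V k f \<tau>)\<^sup>2 \<noteq> 0\<close> with \<open>f\<close>.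
  This replaces the decomposition of the function space into the eigenspaces of the Johnson scheme.
\<close>

lemma eigenvalue_harmonic_level:
  fixes X :: "'a set \<Rightarrow> 'a set \<Rightarrow> real"
  assumes V: "finite V"
    and sym: "\<And>\<alpha> \<beta>. \<alpha> \<in> nsets V k \<Longrightarrow> \<beta> \<in> nsets V k \<Longrightarrow> X \<alpha> \<beta> = X \<beta> \<alpha>"
    and lift: "\<And>e h \<alpha>. e \<le> k \<Longrightarrow> harmonic V e h \<Longrightarrow> \<alpha> \<in> nsets V k \<Longrightarrow>
      (\<Sum>\<beta>\<in>nsets V k. X \<alpha> \<beta> * lift_sum e h \<beta>) = \<mu> e * lift_sum e h \<alpha>"
    and f: "\<exists>\<alpha>\<in>nsets V k. f \<alpha> \<noteq> 0"
    and eig: "\<And>\<alpha>. \<alpha> \<in> nsets V k \<Longrightarrow> (\<Sum>\<beta>\<in>nsets V k. X \<alpha> \<beta> * f \<beta>) = x * f \<alpha>"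
  shows "\<exists>e\<le>k. x = \<mu> e"
proof -
  define h where "h = star_sum V k f"
  define p where "p e \<longleftrightarrow> (\<exists>\<tau>\<in>nsets V e. h \<tau> \<noteq> 0)" for e
  have pk: "p k" using f by (auto simp: p_def h_def star_sum_full_level)
  define e where "e = (LEAST e. p e)"
  have e: "e \<le> k" using pk by (simp add: e_def Least_le)
  have pe: "p e" using pk unfolding e_def by (rule LeastI)
  have harm: "harmonic V e h"
    unfolding h_def
  proof (rule harmonic_star_sum[OF V])
    fix \<rho> assume r: "\<rho> \<subseteq> V" "card \<rho> < e"
    then have "\<not> p (card \<rho>)" unfolding e_def using not_less_Least by blast
    with r V show "star_sum V k f \<rho> = 0"
      by (auto simp: p_def h_def nsets_def intro: finite_subset)
  qed
  define g where "g = lift_sum e h"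
  define I where "I = (\<Sum>\<alpha>\<in>nsets V k. f \<alpha> * g \<alpha>)"
  have "I = (\<Sum>\<tau>\<in>nsets V e. h \<tau> * h \<tau>)"
    using sum_mult_lift_sum[OF V] by (simp add: I_def g_def h_def)
  also have "\<dots> \<noteq> 0"
    using pe V by (auto simp: p_def sum_nonneg_eq_0_iff)
  finally have I: "I \<noteq> 0" .
  have "x * I = (\<Sum>\<alpha>\<in>nsets V k. (\<Sum>\<beta>\<in>nsets V k. X \<alpha> \<beta> * f \<beta>) * g \<alpha>)"
    by (simp add: I_def eig sum_distrib_left mult.assoc)
  also have "\<dots> = (\<Sum>\<beta>\<in>nsets V k. \<Sum>\<alpha>\<in>nsets V k. X \<alpha> \<beta> * f \<beta> * g \<alpha>)"
    unfolding sum_distrib_right by (rule sum.swap)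
  \<comment> \<open>Symmetry moves \<open>X\<close> from \<open>f\<close> to the lift
    \<open>g\<close>, on which its action is known.\<close>
  also have "\<dots> = (\<Sum>\<beta>\<in>nsets V k. f \<beta> * (\<Sum>\<alpha>\<in>nsets V k. X \<beta> \<alpha> * g \<alpha>))"
    unfolding sum_distrib_left by (intro sum.cong refl) (simp add: sym)
  also have "\<dots> = (\<Sum>\<beta>\<in>nsets V k. f \<beta> * (\<mu> e * g \<beta>))"
    using lift[OF e harm] by (simp add: g_def)
  also have "\<dots> = \<mu> e * I"
    by (simp add: I_def sum_distrib_left mult.left_commute)
  finally have "x = \<mu> e" using I by simp
  with e show ?thesis by blast
qed

section \<open>Lower bound for the entries of \<open>M_matrix\<close>\<close>

text \<open>If the sets share at least two points, both \<open>D_matrix\<close> entries vanish and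
  the entry is exactly 1. If they are disjoint, the entry of \<open>A2_matrix\<close> is
  nonpositive, which amounts to \<open>k * (a + 1 - k) \<le> (k - 1) * (a - 1)\<close> with
  \<open>a = n - k\<close>, a rewriting of the bound on \<open>n\<close>.\<close>

lemma M_matrix_entry_ge_1:
  assumes k: "2 \<le> k" and n: "n \<le> k\<^sup>2 - k + 1"
    and A: "A \<in> nsets {1..n} k" and B: "B \<in> nsets {1..n} k" and AB: "card (A \<inter> B) \<noteq> 1"
  shows "1 \<le> M_matrix n k A B"
proof (cases "A \<inter> B = {}")
  case False
  have "finite A" using A by (simp add: nsets_def)
  then have "2 \<le> card (A \<inter> B)"
    using False AB by (metis One_nat_def card_0_eq finite_Int less_2_cases not_less)
  then have "D_matrix k A B = 0" "D_matrix (k - 1) A B = 0"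
    using k by (auto simp: D_matrix_inter[OF A])
  then show ?thesis by (simp add: M_matrix_def J_matrix_def A2_matrix_explicit[OF k])
next
  case True
  \<comment> \<open>Two disjoint \<open>k\<close>-sets force \<open>2 * k \<le> n\<close>, which
    makes the denominators positive.\<close>
  have "card (A \<union> B) = k + k"
    using A B True by (simp add: nsets_def card_Un_disjoint)
  moreover have "card (A \<union> B) \<le> card {1..n}"
    using A B by (intro card_mono) (auto simp: nsets_def)
  ultimately have n2: "2 * k \<le> n" by simp
  define a where "a = n - k"
  have a: "n = k + a" "k \<le> a" using n2 by (auto simp: a_def)
  define P Q where "P = real ((a - 2) choose (k - 2))" "Q = real ((a - 1) choose (k - 2))"
  have pos: "P > 0" "Q > 0" using a k by (auto simp: P_Q_def)
  have gP: "(real n - real k - 2) gchoose (k - 2) = P"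
    and gQ: "(real n - real k - 1) gchoose (k - 2) = Q"
    and PQ: "(real a + 1 - real k) * Q = (real a - 1) * P"
    using A2_denominators[OF k a(2)] by (simp_all add: P_Q_def a)
  \<comment> \<open>Ensures that \<open>k\<^sup>2 - k\<close> is not truncated.\<close>
  have "k \<le> k\<^sup>2" by (simp add: power2_eq_square)
  then have "a + 2 * k \<le> k\<^sup>2 + 1" using n a by linarith
  then have "real (a + 2 * k) \<le> real (k\<^sup>2 + 1)" by (simp only: of_nat_le_iff)
  then have "real k * (real a + 1 - real k) \<le> (real k - 1) * (real a - 1)"
    by (simp add: power2_eq_square algebra_simps)
  from mult_right_mono[OF this, of P]
  have "(real a + 1 - real k) * (real k * P) \<le> (real k - 1) * ((real a - 1) * P)"
    using pos by (simp add: mult_ac)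
  also have "\<dots> = (real a + 1 - real k) * ((real k - 1) * Q)"
    unfolding PQ[symmetric] by simp
  finally have "real k * P \<le> (real k - 1) * Q"
    by (rule mult_left_le_imp_le) (use a in simp)
  then have "real k / Q \<le> (real k - 1) / P"
    using pos by (simp add: field_simps)
  moreover have "D_matrix k A B = 1" "D_matrix (k - 1) A B = real k"
    using k True binomial_symmetric[of "k - 1" k] by (simp_all add: D_matrix_inter[OF A])
  ultimately have "A2_matrix n k A B \<le> 0"
    unfolding A2_matrix_explicit[OF k] gP gQ using k by (simp add: of_nat_diff)
  then show ?thesis by (simp add: M_matrix_def J_matrix_def mult_nonneg_nonpos)
qed

theorem theorem9:
  fixes n k :: nat
  assumes "k \<ge> 2"
    and "(real n - real k - 2) gchoose (k - 2) \<noteq> 0"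
    and "(real n - real k - 1) gchoose (k - 2) \<noteq> 0"
  shows "(n \<le> k^2 - k + 1 \<longrightarrow>
           (\<forall>A \<in> nsets {1..n} k. \<forall>B \<in> nsets {1..n} k.
              card (A \<inter> B) \<noteq> 1 \<longrightarrow> M_matrix n k A B \<ge> 1)) \<and>
         (n \<ge> 3 * k - 3 \<longrightarrow>
           (\<forall>e. bij_betw e {..<n choose k} (nsets {1..n} k) \<longrightarrow>
              eigenvalue (enum_matrix (n choose k) e (M_matrix n k)) (real ((n - 2) choose (k - 2))) \<and>
              (\<forall>x. eigenvalue (enum_matrix (n choose k) e (M_matrix n k)) x
                     \<longrightarrow> x \<le> real ((n - 2) choose (k - 2)))))"
proof (intro conjI impI ballI allI)
  fix A B
  assume "n \<le> k^2 - k + 1" "A \<in> nsets {1..n} k" "B \<in> nsets {1..n} k" "card (A \<inter> B) \<noteq> 1"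
  then show "M_matrix n k A B \<ge> 1"
    using assms(1) by (intro M_matrix_entry_ge_1)
next
  fix e
  assume n: "n \<ge> 3 * k - 3" and e: "bij_betw e {..<n choose k} (nsets {1..n} k)"
  let ?C = "real ((n - 2) choose (k - 2))"
  \<comment> \<open>The all-ones vector is the lift of a constant from level 0 and serves as the
    eigenvector for \<open>?C\<close>.\<close>
  have "harmonic {1..n} 0 (\<lambda>_. 1)" by (simp add: harmonic_def)
  moreover have "lift_sum 0 (\<lambda>_. 1) \<beta> = 1" for \<beta> :: "nat set"
  proof -
    have "nsets \<beta> 0 = {{}}" by (auto simp: nsets_def)
    then show ?thesis by (simp add: lift_sum_def)
  qed
  ultimately have "(\<Sum>\<beta>\<in>nsets {1..n} k. M_matrix n k \<alpha> \<beta> * 1) = ?C * 1"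
    if "\<alpha> \<in> nsets {1..n} k" for \<alpha>
    using M_matrix_lift_sum[OF assms(1) _ _ that, of 0 "\<lambda>_. 1"] A2_eigenvalue_0[OF assms(1) n] by simp
  moreover have "nsets {1..n} k \<noteq> {}"
    using n assms(1) by (simp add: nsets_eq_empty_iff)
  ultimately show "eigenvalue (enum_matrix (n choose k) e (M_matrix n k)) ?C"
    unfolding eigenvalue_enum_matrix_iff[OF e] by (intro exI[of _ "\<lambda>_. 1"]) auto
next
  fix e x
  assume n: "n \<ge> 3 * k - 3" and e: "bij_betw e {..<n choose k} (nsets {1..n} k)"
    and x: "eigenvalue (enum_matrix (n choose k) e (M_matrix n k)) x"
  let ?C = "real ((n - 2) choose (k - 2))"
  obtain f where f: "\<exists>\<alpha>\<in>nsets {1..n} k. f \<alpha> \<noteq> 0"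
    and eig: "\<And>\<alpha>. \<alpha> \<in> nsets {1..n} k \<Longrightarrow> (\<Sum>\<beta>\<in>nsets {1..n} k. M_matrix n k \<alpha> \<beta> * f \<beta>) = x * f \<alpha>"
    using x unfolding eigenvalue_enum_matrix_iff[OF e] by blast
  define \<mu> where "\<mu> j = (if j = 0 then real (n choose k) else 0) - ?C * A2_eigenvalue n k j" for j
  have "\<exists>j\<le>k. x = \<mu> j"
    using M_matrix_lift_sum[OF assms(1)]
    by (intro eigenvalue_harmonic_level[OF _ M_matrix_commute _ f eig]) (auto simp: \<mu>_def)
  then obtain j where j: "j \<le> k" "x = \<mu> j" by blast
  show "x \<le> ?C"
  \<comment> \<open>Level 0 gives \<open>?C\<close> itself; on every other level the all-ones matrix
    contributes nothing, and the bound -1 for \<open>A2_eigenvalue\<close> suffices.\<close>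
  proof (cases "j = 0")
    case True
    with j A2_eigenvalue_0[OF assms(1) n] show ?thesis by (simp add: \<mu>_def)
  next
    case False
    with j have "- 1 \<le> A2_eigenvalue n k j" by (intro A2_eigenvalue_ge assms(1) n) auto
    from mult_left_mono[OF this, of ?C] have "- ?C \<le> ?C * A2_eigenvalue n k j" by simp
    with False j show ?thesis by (simp add: \<mu>_def)
  qed
qed

end
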